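(* Let $\tau\in\mathbb{C}$ with $\operatorname{Im}\tau>0$. Suppose that $m$ and $n$ are positive integers such that $mn$ is even, and that $y_1,y_2,\dots,y_n$ are $n$ complex numbers such that $y_1+y_2+\cdots+y_n=0$. Then for all $z\in\mathbb{C}$, $$\sum_{k=0}^{mn-1}(-1)^k\prod_{j=1}^n\theta_3\left(z+y_j+\frac{k\pi}{mn}\,\Big|\,\tau\right)=H_{m,n}(y_1,y_2,\dots,y_n|\tau)\,\theta_2(mnz\,|\,m^2n\tau),$$ where $$H_{m,n}(y_1,y_2,\dots,y_n|\tau)=mn\,q^{-\frac{m^2n}{8}}\sum_{\substack{s_1,\dots,s_n=-\infty\\ s_1+\cdots+s_n=\frac{mn}{2}}}^{\infty}q^{\frac12(s_1^2+s_2^2+\cdots+s_n^2)}e^{2i(s_1y_1+s_2y_2+\cdots+s_ny_n)},$$ the sum being over all integers $s_1,\dots,s_n$ with the indicated sum.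
   Context: For $\operatorname{Im}\tau>0$ put $q=e^{2\pi i\tau}$, and for real $a$ let $q^a:=e^{2\pi i a\tau}$. The Jacobi theta functions used are, for $z\in\mathbb{C}$, $$\theta_2(z|\tau)=q^{\frac18}\sum_{n=-\infty}^{\infty}q^{\frac{n(n+1)}{2}}e^{(2n+1)iz},\qquad \theta_3(z|\tau)=\sum_{n=-\infty}^{\infty}q^{\frac{n^2}{2}}e^{2niz}.$$ When the second argument is $c\tau$ for a constant $c>0$, $q$ is replaced by $e^{2\pi i c\tau}$ in these definitions. *)

theory Defs
  imports "HOL-Analysis.Analysis"
begin

text \<open>
  \<open>qpow \<tau> a\<close> is $q^a$ for real \<open>a\<close>, where $q = e^{2\pi i\tau}$. It is an entire function of \<open>\<tau>\<close>,
  so no branch of a complex power of $q$ is involved.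
\<close>
definition qpow :: "complex \<Rightarrow> real \<Rightarrow> complex" where
  "qpow \<tau> a = exp (2 * of_real pi * \<i> * of_real a * \<tau>)"

definition theta2 :: "complex \<Rightarrow> complex \<Rightarrow> complex" where
  "theta2 z \<tau> = qpow \<tau> (1 / 8) *
     (\<Sum>\<^sub>\<infinity>n\<in>(UNIV :: int set).
        qpow \<tau> (of_int (n * (n + 1)) / 2) * exp (of_int (2 * n + 1) * \<i> * z))"

definition theta3 :: "complex \<Rightarrow> complex \<Rightarrow> complex" where
  "theta3 z \<tau> =
     (\<Sum>\<^sub>\<infinity>n\<in>(UNIV :: int set).
        qpow \<tau> (of_int (n\<^sup>2) / 2) * exp (2 * of_int n * \<i> * z))"

text \<open>
  Integer tuples $(s_1,\dots,s_n)$ with sum $mn/2$; extensionality makes each tuple occur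
  exactly once.
\<close>
definition H_index :: "nat \<Rightarrow> nat \<Rightarrow> (nat \<Rightarrow> int) set" where
  "H_index m n =
     {s \<in> {1..n} \<rightarrow>\<^sub>E (UNIV :: int set). real_of_int (\<Sum>j=1..n. s j) = real (m * n) / 2}"

text \<open>Only the values \<open>y 1, \<dots>, y n\<close> matter.\<close>
definition H :: "nat \<Rightarrow> nat \<Rightarrow> (nat \<Rightarrow> complex) \<Rightarrow> complex \<Rightarrow> complex" where
  "H m n y \<tau> = of_nat (m * n) * qpow \<tau> (- (real (m\<^sup>2 * n) / 8)) *
     (\<Sum>\<^sub>\<infinity>s\<in>H_index m n.
        qpow \<tau> (1 / 2 * of_int (\<Sum>j=1..n. (s j)\<^sup>2)) *
        exp (2 * \<i> * (\<Sum>j=1..n. of_int (s j) * y j)))"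

end

theory Submission
  imports Defs
begin

text \<open>
  The proof expands both sides into absolutely convergent exponential series and compares them.
  Multiplying out the \<open>n\<close> theta series turns each product on the left into a sum over the lattice
  of integer tuples \<open>s\<close> (\<open>prod_theta3_eq_infsum\<close>). The translation by \<open>k\<pi>/(mn)\<close> affects the summand
  of \<open>s\<close> only through the character $e^{2ikS\pi/(mn)}$ of its total $S = s_1 + \cdots + s_n$. The alternating sum over
  \<open>k\<close> is therefore a sum over roots of unity: it is \<open>mn\<close> when $S \equiv mn/2$ modulo \<open>mn\<close> and
  vanishes otherwise (\<open>alternating_character_sum\<close>).

  A tuple whose total is $mn/2 + mnr$ is obtained in exactly one way by adding $mr$ to every entry
  of a tuple \<open>t\<close> with total $mn/2$ (\<open>bij_betw_translates_of_H_index\<close>). This translation changes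
  the sum of the squares of the entries by
  $2mr \cdot mn/2 + nm^2r^2 = m^2n\,r(r+1)$, which depends on \<open>r\<close> alone, and since
  $y_1 + \cdots + y_n = 0$ it does not change
  $t_1y_1 + \cdots + t_ny_n$. So every summand is a product of a function of \<open>t\<close> and a
  function of \<open>r\<close> (\<open>lattice_term_shift\<close>). The sum over \<open>t\<close> is the one in \<open>H\<close>, and the sum over \<open>r\<close>
  is the series of \<open>theta2\<close> with the variables \<open>mnz\<close> and \<open>m\<^sup>2n\<tau>\<close>.
\<close>

section \<open>Powers of the nome\<close>

lemma qpow_add: "qpow \<tau> (a + b) = qpow \<tau> a * qpow \<tau> b"
  by (simp add: qpow_def exp_add [symmetric] algebra_simps)

lemma qpow_scaled: "qpow (of_nat c * \<tau>) a = qpow \<tau> (real c * a)"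
  by (simp add: qpow_def mult_ac)

lemma qpow_sum: "finite A \<Longrightarrow> qpow \<tau> (\<Sum>j\<in>A. f j) = (\<Prod>j\<in>A. qpow \<tau> (f j))"
  by (simp add: qpow_def exp_sum [symmetric] sum_distrib_left sum_distrib_right)

lemma norm_qpow: "norm (qpow \<tau> a) = exp (- (2 * pi * a * Im \<tau>))"
  by (simp add: qpow_def)

section \<open>Absolute convergence\<close>

text \<open>A summable majorant for the theta series: after completing the square, the Gaussian decay
  absorbs the linear exponent with room for one more factor $e^{-|k|}$.\<close>
lemma summable_exp_minus_abs_int: "(\<lambda>k::int. exp (- \<bar>real_of_int k\<bar>)) summable_on UNIV"
proof -
  have nat: "(\<lambda>k::nat. exp (- real k)) summable_on UNIV"
  proof -
    have "summable (\<lambda>k::nat. exp (-1::real) ^ k)"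
      by (rule summable_geometric) simp
    then have "summable (\<lambda>k::nat. exp (- real k))"
      by (simp flip: exp_of_nat_mult)
    then show ?thesis
      by (intro norm_summable_imp_summable_on) simp
  qed
  have pos: "(\<lambda>k::int. exp (- \<bar>real_of_int k\<bar>)) summable_on {0..}"
    by (rule summable_on_reindex_bij_betw [THEN iffD1, OF _ nat [THEN summable_on_cong [THEN iffD1, rotated]]])
       (auto intro!: bij_betwI [where f = int and g = nat])
  have neg: "(\<lambda>k::int. exp (- \<bar>real_of_int k\<bar>)) summable_on {..<0}"
  proof -
    have "bij_betw uminus {0<..} {..<(0::int)}"
      by (auto intro!: bij_betwI [where g = uminus])
    moreover have "(\<lambda>k::int. exp (- \<bar>real_of_int (- k)\<bar>)) summable_on {0<..}"
      unfolding of_int_minus abs_minus_cancel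
      using pos by (rule summable_on_subset_banach) auto
    ultimately show ?thesis
      using summable_on_reindex_bij_betw by blast
  qed
  have "(\<lambda>k::int. exp (- \<bar>real_of_int k\<bar>)) summable_on {0..} \<union> {..<0}"
    by (rule summable_on_Un_disjoint [OF pos neg]) auto
  also have "{0..} \<union> {..<0} = (UNIV :: int set)" by auto
  finally show ?thesis .
qed

lemma theta3_summand_norm_summable:
  assumes "Im \<tau> > 0"
  shows "(\<lambda>k::int. norm (qpow \<tau> (of_int (k\<^sup>2) / 2) * exp (2 * of_int k * \<i> * w))) summable_on UNIV"
proof -
  define a where "a = pi * Im \<tau>"
  \<comment> \<open>The linear exponent contributes at most \<open>2\<bar>Im w\<bar>\<bar>k\<bar>\<close>; the extra 1 pays for the majorant.
    The maximum of \<open>b x - a x\<^sup>2\<close> is \<open>b\<^sup>2 / (4 a)\<close>.\<close>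
  define b where "b = 2 * \<bar>Im w\<bar> + 1"
  have a: "a > 0" using assms by (simp add: a_def)
  show ?thesis
  proof (rule Infinite_Sum.abs_summable_on_comparison_test')
    show "(\<lambda>k::int. exp (b\<^sup>2 / (4 * a)) * exp (- \<bar>real_of_int k\<bar>)) summable_on UNIV"
      by (intro summable_on_cmult_right summable_exp_minus_abs_int)
  next
    fix k :: int
    have "- (a * (of_int k)\<^sup>2) - 2 * of_int k * Im w \<le> b\<^sup>2 / (4 * a) - \<bar>real_of_int k\<bar>"
    proof -
      have complete_square: "4 * a * (b * x - a * x\<^sup>2) = b\<^sup>2 - (2 * a * x - b)\<^sup>2" for x
        by (simp add: power2_eq_square algebra_simps)
      have "4 * a * (b * \<bar>real_of_int k\<bar> - a * (of_int k)\<^sup>2) \<le> b\<^sup>2"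
        using complete_square [of "\<bar>real_of_int k\<bar>"] by simp
      then have "b * \<bar>real_of_int k\<bar> - a * (of_int k)\<^sup>2 \<le> b\<^sup>2 / (4 * a)"
        using a by (simp add: pos_le_divide_eq mult.commute)
      moreover have "- 2 * of_int k * Im w \<le> 2 * \<bar>real_of_int k\<bar> * \<bar>Im w\<bar>"
        using abs_ge_minus_self [of "of_int k * Im w"] by (simp add: abs_mult mult_ac)
      ultimately show ?thesis by (simp add: b_def algebra_simps)
    qed
    then show "norm (qpow \<tau> (of_int (k\<^sup>2) / 2) * exp (2 * of_int k * \<i> * w))
        \<le> exp (b\<^sup>2 / (4 * a)) * exp (- \<bar>real_of_int k\<bar>)"
      by (simp add: norm_mult norm_qpow a_def algebra_simps flip: exp_add)
  qed
qed

text \<open>By the product formula for infinite sums, the sum of the norms is the product of the factors'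
  norm sums. A family without a sum has \<open>infsum\<close> equal to 0, so if this product is nonzero
  the family must be summable. If some factor has norm sum 0, all products vanish.\<close>
lemma prod_PiE_norm_summable:
  fixes f :: "'a \<Rightarrow> 'b \<Rightarrow> complex"
  assumes "finite A" and summable: "\<And>x. x \<in> A \<Longrightarrow> (\<lambda>y. norm (f x y)) summable_on B x"
  shows "(\<lambda>g. norm (\<Prod>x\<in>A. f x (g x))) summable_on PiE A B"
proof (cases "\<forall>x\<in>A. infsum (\<lambda>y. norm (f x y)) (B x) \<noteq> 0")
  case True
  have "infsum (\<lambda>g. \<Prod>x\<in>A. norm (f x (g x))) (PiE A B) = (\<Prod>x\<in>A. infsum (\<lambda>y. norm (f x y)) (B x))"
    by (rule infsum_prod_PiE_abs) (use assms in auto)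
  also have "\<dots> \<noteq> 0"
    using True \<open>finite A\<close> by simp
  finally have "(\<lambda>g. \<Prod>x\<in>A. norm (f x (g x))) summable_on PiE A B"
    using infsum_not_exists by blast
  then show ?thesis by (simp add: prod_norm)
next
  case False
  then obtain x where x: "x \<in> A" "infsum (\<lambda>y. norm (f x y)) (B x) = 0" by blast
  then have "norm (f x y) = 0" if "y \<in> B x" for y
    using nonneg_infsum_le_0D [of "\<lambda>y. norm (f x y)" "B x" y] summable that by simp
  then have "norm (\<Prod>x\<in>A. f x (g x)) = 0" if "g \<in> PiE A B" for g
    using that x \<open>finite A\<close> by (auto simp: PiE_iff)
  then show ?thesis
    by (metis (no_types, lifting) summable_on_0)
qed

lemma infsum_finite_sum:
  fixes f :: "'a \<Rightarrow> 'b \<Rightarrow> 'c :: {topological_comm_monoid_add, t2_space}"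
  assumes "\<And>k. k \<in> F \<Longrightarrow> f k summable_on A"
  shows "(\<Sum>k\<in>F. infsum (f k) A) = (\<Sum>\<^sub>\<infinity>x\<in>A. \<Sum>k\<in>F. f k x)"
proof -
  have "((\<lambda>x. \<Sum>k\<in>F. f k x) has_sum (\<Sum>k\<in>F. infsum (f k) A)) A"
    using assms by (induction F rule: infinite_finite_induct) (auto intro: has_sum_add)
  then show ?thesis by (simp add: infsumI)
qed

section \<open>Products of theta functions as lattice sums\<close>

text \<open>The summand of \<open>s\<close> in the product of the series \<open>theta3 (w j) \<tau>\<close>, in the form in which it occurs in \<open>H\<close>.\<close>
definition lattice_term :: "complex \<Rightarrow> 'a set \<Rightarrow> ('a \<Rightarrow> complex) \<Rightarrow> ('a \<Rightarrow> int) \<Rightarrow> complex" where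
  "lattice_term \<tau> A w s =
     qpow \<tau> (1 / 2 * of_int (\<Sum>j\<in>A. (s j)\<^sup>2)) * exp (2 * \<i> * (\<Sum>j\<in>A. of_int (s j) * w j))"

lemma lattice_term_eq_prod:
  assumes "finite A"
  shows "lattice_term \<tau> A w s =
    (\<Prod>j\<in>A. qpow \<tau> (of_int ((s j)\<^sup>2) / 2) * exp (2 * of_int (s j) * \<i> * w j))"
proof -
  have "1 / 2 * real_of_int (\<Sum>j\<in>A. (s j)\<^sup>2) = (\<Sum>j\<in>A. of_int ((s j)\<^sup>2) / 2)"
    by (simp add: sum_divide_distrib)
  moreover have "2 * \<i> * (\<Sum>j\<in>A. of_int (s j) * w j) = (\<Sum>j\<in>A. 2 * of_int (s j) * \<i> * w j)"
    by (simp add: sum_distrib_left mult_ac)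
  ultimately show ?thesis
    unfolding lattice_term_def
    by (simp only: prod.distrib qpow_sum [OF assms] exp_sum [OF assms])
qed

lemma lattice_term_summable:
  assumes "Im \<tau> > 0" "finite A"
  shows "lattice_term \<tau> A w summable_on PiE A (\<lambda>_. UNIV)"
proof -
  have "(\<lambda>s. norm (lattice_term \<tau> A w s)) summable_on PiE A (\<lambda>_. UNIV)"
    unfolding lattice_term_eq_prod [OF assms(2)]
    by (rule prod_PiE_norm_summable [OF assms(2) theta3_summand_norm_summable [OF assms(1)]])
  then show ?thesis by (rule abs_summable_summable)
qed

lemma prod_theta3_eq_infsum:
  assumes "Im \<tau> > 0" "finite A"
  shows "(\<Prod>j\<in>A. theta3 (w j) \<tau>) = (\<Sum>\<^sub>\<infinity>s\<in>PiE A (\<lambda>_. UNIV). lattice_term \<tau> A w s)"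
  unfolding theta3_def lattice_term_eq_prod [OF assms(2)]
  by (rule infsum_prod_PiE_abs [symmetric])
     (use assms theta3_summand_norm_summable in auto)

lemma lattice_term_translate:
  "lattice_term \<tau> A (\<lambda>j. w j + c) s =
     lattice_term \<tau> A w s * exp (2 * \<i> * of_int (\<Sum>j\<in>A. s j) * c)"
  by (simp add: lattice_term_def sum.distrib sum_distrib_left sum_distrib_right
        algebra_simps exp_add)

text \<open>The cross term in the sum of the squares is $2mr$ times the total of \<open>t\<close>. Because that total is half of
  \<open>m * card A\<close>, it combines with $(mr)^2$ into the exponent $r(r+1)$ of the
  second theta function; the condition on \<open>w\<close> keeps the characters of \<open>w\<close> unaffected.\<close>
lemma lattice_term_shift:
  fixes m :: nat and r :: int
  assumes "finite A" and sum_w: "(\<Sum>j\<in>A. w j) = 0"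
    and sum_t: "2 * (\<Sum>j\<in>A. t j) = int (m * card A)"
  shows "lattice_term \<tau> A (\<lambda>j. w j + z) (\<lambda>j\<in>A. t j + int m * r) =
    lattice_term \<tau> A w t *
      (qpow \<tau> (real (m\<^sup>2 * card A) * (of_int (r * (r + 1)) / 2)) *
       exp (of_int (2 * r + 1) * \<i> * (of_nat (m * card A) * z)))"
proof -
  let ?n = "card A"
  have squares: "(\<Sum>j\<in>A. (t j + int m * r)\<^sup>2) = (\<Sum>j\<in>A. (t j)\<^sup>2) + int (m\<^sup>2 * ?n) * (r * (r + 1))"
  proof -
    have "(\<Sum>j\<in>A. (t j + int m * r)\<^sup>2)
        = (\<Sum>j\<in>A. (t j)\<^sup>2) + int m * r * (2 * (\<Sum>j\<in>A. t j)) + int ?n * (int m * r)\<^sup>2"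
      by (simp add: power2_sum sum.distrib sum_distrib_left sum_distrib_right algebra_simps)
    also have "\<dots> = (\<Sum>j\<in>A. (t j)\<^sup>2) + int (m\<^sup>2 * ?n) * (r * (r + 1))"
      unfolding sum_t by (simp add: power2_eq_square algebra_simps)
    finally show ?thesis .
  qed
  have linear: "(\<Sum>j\<in>A. of_int (t j + int m * r) * w j) = (\<Sum>j\<in>A. of_int (t j) * w j)"
  proof -
    have "(\<Sum>j\<in>A. of_int (t j + int m * r) * w j)
        = (\<Sum>j\<in>A. of_int (t j) * w j) + of_nat m * of_int r * (\<Sum>j\<in>A. w j)"
      by (simp add: sum.distrib sum_distrib_left algebra_simps)
    then show ?thesis by (simp add: sum_w)
  qed
  have total: "2 * (\<Sum>j\<in>A. t j + int m * r) = int (m * ?n) * (2 * r + 1)"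
    using sum_t by (simp add: sum.distrib algebra_simps)
  have "2 * \<i> * of_int (\<Sum>j\<in>A. t j + int m * r) * z
      = of_int (2 * (\<Sum>j\<in>A. t j + int m * r)) * \<i> * z"
    by simp
  also have "\<dots> = of_int (2 * r + 1) * \<i> * (of_nat (m * ?n) * z)"
    unfolding total by simp
  finally have character: "2 * \<i> * of_int (\<Sum>j\<in>A. t j + int m * r) * z
      = of_int (2 * r + 1) * \<i> * (of_nat (m * ?n) * z)" .
  have half: "1 / 2 * real_of_int ((\<Sum>j\<in>A. (t j)\<^sup>2) + int (m\<^sup>2 * ?n) * (r * (r + 1)))
      = 1 / 2 * real_of_int (\<Sum>j\<in>A. (t j)\<^sup>2) + real (m\<^sup>2 * ?n) * (of_int (r * (r + 1)) / 2)"
    by (simp add: algebra_simps add_divide_distrib)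
  have "lattice_term \<tau> A (\<lambda>j. w j + z) (\<lambda>j\<in>A. t j + int m * r)
      = lattice_term \<tau> A (\<lambda>j. w j + z) (\<lambda>j. t j + int m * r)"
    by (simp add: lattice_term_def cong: sum.cong_simp)
  also have "\<dots> = lattice_term \<tau> A w (\<lambda>j. t j + int m * r)
      * exp (2 * \<i> * of_int (\<Sum>j\<in>A. t j + int m * r) * z)"
    by (rule lattice_term_translate)
  also have "\<dots> = lattice_term \<tau> A w t *
      (qpow \<tau> (real (m\<^sup>2 * ?n) * (of_int (r * (r + 1)) / 2)) *
       exp (of_int (2 * r + 1) * \<i> * (of_nat (m * ?n) * z)))"
    unfolding lattice_term_def character linear squares half qpow_add by (simp only: mult_ac)
  finally show ?thesis .
qed

section \<open>Selecting a residue class\<close>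

text \<open>For even \<open>N\<close> the sign $(-1)^k$ is $e^{-2\pi i k (N/2)/N}$, so this is a geometric sum of powers of
  \<open>\<zeta>\<close>, the \<open>N\<close>-th root of unity with exponent $S - N/2$.\<close>
lemma alternating_character_sum:
  fixes N :: nat and S :: int
  assumes "N > 0" "even N"
  shows "(\<Sum>k<N. (-1) ^ k * exp (2 * \<i> * of_int S * (of_nat k * of_real pi / of_nat N)))
    = (if int N dvd S - int (N div 2) then of_nat N else 0)"
proof -
  define \<zeta> where "\<zeta> = exp (2 * pi * \<i> * (of_int (S - int (N div 2)) / of_nat N))"
  have half: "of_nat (N div 2) / of_nat N = (1 / 2 :: complex)"
    using assms by (auto elim!: evenE)
  have "exp (2 * pi * \<i> * (of_int (S - int (N div 2)) / of_nat N))
      = exp (2 * \<i> * of_int S * (of_real pi / of_nat N) - of_real pi * \<i>)"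
    by (rule arg_cong [where f = exp]) (simp add: diff_divide_distrib half algebra_simps)
  then have \<zeta>: "\<zeta> = - exp (2 * \<i> * of_int S * (of_real pi / of_nat N))"
    by (simp add: \<zeta>_def exp_diff)
  have summand: "(-1) ^ k * exp (2 * \<i> * of_int S * (of_nat k * of_real pi / of_nat N)) = \<zeta> ^ k" for k
    unfolding \<zeta> by (simp add: power_minus [of "exp _"] mult_ac flip: exp_of_nat_mult)
  have one_iff: "\<zeta> = 1 \<longleftrightarrow> int N dvd S - int (N div 2)"
  proof -
    define x where "x = real_of_int (S - int (N div 2)) / real N"
    have "\<zeta> = exp (of_real (2 * pi * x) * \<i>)"
      by (simp add: \<zeta>_def x_def mult_ac)
    then have "\<zeta> = 1 \<longleftrightarrow> (\<exists>k::int. 2 * pi * x = of_int (2 * k) * pi)"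
      by (simp add: exp_eq_1)
    also have "\<dots> \<longleftrightarrow> (\<exists>k::int. real_of_int (S - int (N div 2)) / real N = of_int k)"
      unfolding x_def [symmetric] by simp
    also have "\<dots> \<longleftrightarrow> (\<exists>k::int. real_of_int (S - int (N div 2)) = real_of_int (int N * k))"
      using \<open>N > 0\<close> by (simp add: field_simps)
    also have "\<dots> \<longleftrightarrow> int N dvd S - int (N div 2)"
      unfolding of_int_eq_iff by (simp add: dvd_def)
    finally show ?thesis .
  qed
  have "\<zeta> ^ N = exp (2 * pi * \<i> * of_int (S - int (N div 2)))"
    using \<open>N > 0\<close> by (simp add: \<zeta>_def flip: exp_of_nat_mult)
  also have "\<dots> = 1"
    using exp_integer_2pi [of "of_int (S - int (N div 2))"] by (simp add: mult_ac)
  finally have "\<zeta> ^ N = 1" .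
  then show ?thesis
    unfolding summand by (auto simp: sum_gp_strict one_iff)
qed

text \<open>Adding $mr$ to all \<open>n\<close> entries moves the total by $mnr$, so the totals of the translates of
  \<open>H_index m n\<close> run through the residue class of $mn/2$ modulo \<open>mn\<close>, and the total determines \<open>r\<close>.\<close>
lemma bij_betw_translates_of_H_index:
  assumes "m > 0" "n > 0" "even (m * n)"
  shows "bij_betw (\<lambda>(t, r). \<lambda>j\<in>{1..n}. t j + int m * r) (H_index m n \<times> UNIV)
    {s \<in> {1..n} \<rightarrow>\<^sub>E UNIV. int (m * n) dvd (\<Sum>j=1..n. s j) - int (m * n div 2)}"
    (is "bij_betw ?\<phi> _ ?C")
proof (rule bij_betw_imageI)
  have sum_H: "t \<in> H_index m n \<longleftrightarrow> t \<in> {1..n} \<rightarrow>\<^sub>E UNIV \<and> (\<Sum>j=1..n. t j) = int (m * n div 2)" for t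
  proof -
    have "real (m * n) / 2 = real_of_int (int (m * n div 2))"
      using assms(3) by (auto elim!: evenE)
    then show ?thesis
      unfolding H_index_def mem_Collect_eq by (simp only: of_int_eq_iff)
  qed
  have total: "(\<Sum>j=1..n. ?\<phi> (t, r) j) = (\<Sum>j=1..n. t j) + int (m * n) * r" for t r
    by (simp add: sum.distrib cong: sum.cong_simp)
  show "inj_on ?\<phi> (H_index m n \<times> UNIV)"
  proof (rule inj_onI, clarify)
    fix t r t' r'
    assume t: "t \<in> H_index m n" "t' \<in> H_index m n"
      and "(\<lambda>j\<in>{1..n}. t j + int m * r) = (\<lambda>j\<in>{1..n}. t' j + int m * r')"
    then have eq: "?\<phi> (t, r) = ?\<phi> (t', r')" by simp
    have "int (m * n) * r = int (m * n) * r'"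
      using total [of t r] total [of t' r'] t unfolding eq sum_H by linarith
    then have r: "r = r'" using assms by simp
    have "t j = t' j" if "j \<in> {1..n}" for j
      using fun_cong [OF eq, of j] that by (simp add: r)
    then have "t = t'"
      using t unfolding sum_H by (meson PiE_ext)
    with r show "t = t' \<and> r = r'" by simp
  qed
  show "?\<phi> ` (H_index m n \<times> UNIV) = ?C"
  proof (intro equalityI subsetI)
    fix s assume "s \<in> ?\<phi> ` (H_index m n \<times> UNIV)"
    then obtain t r where s: "s = ?\<phi> (t, r)" and "t \<in> H_index m n" by auto
    then have "(\<Sum>j=1..n. s j) - int (m * n div 2) = int (m * n) * r"
      unfolding s total sum_H by simp
    then show "s \<in> ?C" by (auto simp: s)
  next
    fix s assume s: "s \<in> ?C"
    then obtain r where r: "(\<Sum>j=1..n. s j) - int (m * n div 2) = int (m * n) * r"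
      by (auto elim: dvdE)
    define t where "t = (\<lambda>j\<in>{1..n}. s j - int m * r)"
    have "(\<Sum>j=1..n. t j) = (\<Sum>j=1..n. s j) - int (m * n) * r"
      by (simp add: t_def sum_subtractf cong: sum.cong_simp)
    then have "t \<in> H_index m n"
      using r unfolding sum_H by (simp add: t_def)
    moreover have "s = ?\<phi> (t, r)"
      using s by (simp add: t_def fun_eq_iff PiE_arb [of s "{1..n}" "\<lambda>_. UNIV"])
    ultimately show "s \<in> ?\<phi> ` (H_index m n \<times> UNIV)" by blast
  qed
qed

section \<open>The identity\<close>

theorem theorem1p7:
  fixes \<tau> :: complex and m n :: nat and y :: "nat \<Rightarrow> complex"
  assumes "Im \<tau> > 0"
    and "m > 0" and "n > 0" and "even (m * n)"
    and "(\<Sum>j=1..n. y j) = 0"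
  shows "\<forall>z :: complex.
    (\<Sum>k=0..m * n - 1. (-1) ^ k * (\<Prod>j=1..n. theta3 (z + y j + of_nat k * of_real pi / of_nat (m * n)) \<tau>))
      = H m n y \<tau> * theta2 (of_nat (m * n) * z) (of_nat (m\<^sup>2 * n) * \<tau>)"
proof
  fix z :: complex
  let ?N = "m * n" and ?L = "{1..n} \<rightarrow>\<^sub>E (UNIV :: int set)"
  let ?w = "\<lambda>j. y j + z" and ?c = "\<lambda>k::nat. of_nat k * of_real pi / of_nat (m * n) :: complex"
  let ?C = "{s \<in> ?L. int ?N dvd (\<Sum>j=1..n. s j) - int (?N div 2)}"
  let ?\<phi> = "\<lambda>(t, r). \<lambda>j\<in>{1..n}. t j + int m * r"
  define E where "E = lattice_term \<tau> {1..n}"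
  define b where "b r = qpow \<tau> (real (m\<^sup>2 * n) * (of_int (r * (r + 1)) / 2)) *
       exp (of_int (2 * r + 1) * \<i> * (of_nat ?N * z))" for r :: int
  have N: "?N > 0" using assms by simp
  have bij: "bij_betw ?\<phi> (H_index m n \<times> UNIV) ?C"
    by (rule bij_betw_translates_of_H_index) (use assms in auto)
  have summable: "E w summable_on ?L" for w
    unfolding E_def using assms(1) by (intro lattice_term_summable) auto
  have shift: "E ?w (?\<phi> (t, r)) = E y t * b r" if "t \<in> H_index m n" for t r
  proof -
    have "real_of_int (2 * (\<Sum>j=1..n. t j)) = real_of_int (int (m * n))"
      using that by (simp add: H_index_def)
    then have "2 * (\<Sum>j=1..n. t j) = int (m * card {1..n})"
      unfolding of_int_eq_iff by simp
    from lattice_term_shift [OF finite_atLeastAtMost assms(5) this, of \<tau> z r]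
    show ?thesis by (simp add: E_def b_def)
  qed
  have theta2: "theta2 (of_nat ?N * z) (of_nat (m\<^sup>2 * n) * \<tau>) = qpow \<tau> (real (m\<^sup>2 * n) / 8) * infsum b UNIV"
    unfolding theta2_def qpow_scaled b_def by simp

  have "(\<Sum>k=0..?N - 1. (-1) ^ k * (\<Prod>j=1..n. theta3 (z + y j + ?c k) \<tau>))
      = (\<Sum>k<?N. (-1) ^ k * (\<Prod>j=1..n. theta3 (?w j + ?c k) \<tau>))"
    by (rule sum.cong) (metis N Suc_diff_1 atLeast0AtMost lessThan_Suc_atMost, simp only: add.commute)
  also have "\<dots> = (\<Sum>k<?N. (-1) ^ k * (\<Sum>\<^sub>\<infinity>s\<in>?L. E (\<lambda>j. ?w j + ?c k) s))"
    unfolding E_def by (simp only: prod_theta3_eq_infsum [OF assms(1) finite_atLeastAtMost])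
  also have "\<dots> = (\<Sum>\<^sub>\<infinity>s\<in>?L. \<Sum>k<?N. (-1) ^ k * E (\<lambda>j. ?w j + ?c k) s)"
    unfolding infsum_cmult_right' [symmetric]
    by (rule infsum_finite_sum) (intro summable_on_cmult_right summable)
  also have "\<dots> = (\<Sum>\<^sub>\<infinity>s\<in>?L. E ?w s * (if int ?N dvd (\<Sum>j=1..n. s j) - int (?N div 2) then of_nat ?N else 0))"
    unfolding alternating_character_sum [OF N assms(4), symmetric] sum_distrib_left E_def
    by (simp only: lattice_term_translate mult.left_commute)
  also have "\<dots> = (\<Sum>\<^sub>\<infinity>s\<in>?C. of_nat ?N * E ?w s)"
    by (rule infsum_cong_neutral) auto
  also have "\<dots> = of_nat ?N * (\<Sum>\<^sub>\<infinity>s\<in>?C. E ?w s)"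
    by (rule infsum_cmult_right')
  also have "(\<Sum>\<^sub>\<infinity>s\<in>?C. E ?w s) = (\<Sum>\<^sub>\<infinity>p\<in>H_index m n \<times> UNIV. E ?w (?\<phi> p))"
    by (rule infsum_reindex_bij_betw [OF bij, symmetric])
  also have "\<dots> = (\<Sum>\<^sub>\<infinity>t\<in>H_index m n. \<Sum>\<^sub>\<infinity>r\<in>UNIV. E ?w (?\<phi> (t, r)))"
  proof (rule infsum_Sigma_banach [symmetric])
    show "(\<lambda>p. E ?w (?\<phi> p)) summable_on H_index m n \<times> UNIV"
      unfolding summable_on_reindex_bij_betw [OF bij]
      by (rule summable_on_subset_banach [OF summable]) auto
  qed
  also have "\<dots> = (\<Sum>\<^sub>\<infinity>t\<in>H_index m n. E y t * infsum b UNIV)"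
    by (intro infsum_cong) (simp only: shift infsum_cmult_right')
  also have "\<dots> = infsum (E y) (H_index m n) * infsum b UNIV"
    by (rule infsum_cmult_left')
  \<comment> \<open>\<open>H\<close> carries the power of the nome inverse to the prefactor of \<open>theta2\<close>.\<close>
  also have "of_nat ?N * (infsum (E y) (H_index m n) * infsum b UNIV)
      = of_nat ?N * (qpow \<tau> (- (real (m\<^sup>2 * n) / 8)) * qpow \<tau> (real (m\<^sup>2 * n) / 8))
          * infsum (E y) (H_index m n) * infsum b UNIV"
    unfolding qpow_add [symmetric] by (simp add: qpow_def)
  also have "\<dots> = H m n y \<tau> * theta2 (of_nat ?N * z) (of_nat (m\<^sup>2 * n) * \<tau>)"
    unfolding theta2 H_def E_def lattice_term_def by (simp only: mult_ac)
  finally show "(\<Sum>k=0..?N - 1. (-1) ^ k * (\<Prod>j=1..n. theta3 (z + y j + ?c k) \<tau>))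
      = H m n y \<tau> * theta2 (of_nat ?N * z) (of_nat (m\<^sup>2 * n) * \<tau>)" .
qed

end
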